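(* Let $m=1$ and let $\hat\Theta$ be a solution of the dual problem $\min\{J(\Theta):\Theta\in\mathcal{D}_A\}$, where $J(\Theta)=\int\Psi\log(1+G^*\Theta G)^{-1}+\mathrm{tr}(\hat\Sigma\Theta)$. For $\Theta\in\mathcal{D}_A$ let $L_\Theta$ be such that $\mathcal{A}_{\Theta,1}=L_\Theta L_\Theta^*$, and let $\Lambda_\Theta=L_\Theta^{-1}\Omega L_\Theta^{-*}$ be the spectral density of the normalized one-step-ahead prediction error when the actual process has spectral density $\Omega$ and the predictor is based on the model $\mathcal{A}_{\Theta,1}$. Then $\hat\Theta$ solves the prediction error identification problem $$\hat\Theta=\mathrm{argmin}_{\Theta\in\mathcal{D}_A}\ \mathcal{S}_{IS,\Psi}(\Lambda_\Theta\|1).$$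
   Context: Scalar case $m=1$. $\mathcal{S}_1^+$ is the set of scalar spectral densities of real stationary processes (nonnegative functions on the unit circle, symmetric under complex conjugation of the argument) that are bounded and bounded away from zero. $\mathcal{Q}_n$ is the space of real symmetric $n\times n$ matrices. $\int$ is integration over the unit circle with respect to normalized Lebesgue measure; $*$ is conjugate transpose on the unit circle; inequalities between functions hold on the whole unit circle. Setting: $G(z)=(zI-A)^{-1}B$ with $A\in\mathbb{R}^{n\times n}$ having all eigenvalues in the open unit disc, $B\in\mathbb{R}^{n\times1}$, $n>1$, $(A,B)$ reachable. $\Psi\in\mathcal{S}_1^+$ is a prior spectral density of bounded McMillan degree (rational). $\Omega>0$ is the (possibly truncated by the Blackman-Tukey method) biased correlogram computed from real data $\mathrm{y}(1),\dots,\mathrm{y}(N)$ (a trigonometric polynomial, so $\Omega\in\mathcal{S}_1^+$), and $\hat\Sigma=\int G\Omega G^*$. $\mathcal{D}_A=\{\Theta\in\mathcal{Q}_n:1+G^*\Theta G>0\}$ and $\mathcal{A}_{\Theta,1}=\Psi/(1+G^*\Theta G)$. $L_\Theta$ is the Fourier transform of the impulse response of the shaping filter of the model (driven by the normalized innovation, unit-variance white Gaussian noise). The prediction error identification method selects the parameter minimizing a nonnegative cost $V(\Theta,\mathrm{y})$ that is a function of the normalized prediction error of the model with parameter $\Theta$; here $V(\Theta,\mathrm{y})=\mathcal{S}_{IS,\Psi}(\Lambda_\Theta\|1)$, where the weighted Itakura-Saito distance is $\mathcal{S}_{IS,Q}(\Phi_1\|\Phi_2)=\int Q[\log\Phi_2-\log\Phi_1+\Phi_1\Phi_2^{-1}-1]$.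 *)

theory Defs
  imports "HOL-Analysis.Analysis"
begin

abbreviation unit_circle :: "complex set" where
  "unit_circle \<equiv> sphere 0 1"

text \<open>Functions on the unit circle are total functions on \<^typ>\<open>complex\<close>; their values off
  the circle are never used.\<close>

definition circle_integral ::
    "(complex \<Rightarrow> 'a::{banach, second_countable_topology}) \<Rightarrow> 'a" where
  "circle_integral f = (1 / (2 * pi)) *\<^sub>R (LINT \<theta>:{-pi..pi}|lborel. f (cis \<theta>))"

definition spectral_densities :: "(complex \<Rightarrow> real) set" where
  "spectral_densities = {\<Phi>.
     (\<lambda>\<theta>. \<Phi> (cis \<theta>)) \<in> borel_measurable borel \<and>
     (\<forall>z\<in>unit_circle. \<Phi> (cnj z) = \<Phi> z) \<and>
     (\<exists>a>0. \<exists>b. \<forall>z\<in>unit_circle. a \<le> \<Phi> z \<and> \<Phi> z \<le> b)}"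

definition rational_on_circle :: "(complex \<Rightarrow> real) \<Rightarrow> bool" where
  "rational_on_circle \<Phi> \<longleftrightarrow> (\<exists>p q :: real poly. \<forall>z\<in>unit_circle.
     poly (map_poly of_real q) z \<noteq> 0 \<and>
     complex_of_real (\<Phi> z) = poly (map_poly of_real p) z / poly (map_poly of_real q) z)"

definition complex_matrix :: "real^'n^'m \<Rightarrow> complex^'n^'m" where
  "complex_matrix M = (\<chi> i j. of_real (M $ i $ j))"

definition complex_vector :: "real^'n \<Rightarrow> complex^'n" where
  "complex_vector v = (\<chi> i. of_real (v $ i))"

definition eigenvalues_in_open_disc :: "real^'n^'n \<Rightarrow> bool" where
  "eigenvalues_in_open_disc A \<longleftrightarrow>
     (\<forall>\<mu> v. v \<noteq> 0 \<and> complex_matrix A *v v = \<mu> *s v \<longrightarrow> cmod \<mu> < 1)"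

text \<open>The columns \<open>B, A B, \<dots>, A\<^sup>n\<^sup>-\<^sup>1 B\<close> of the reachability matrix span the state space.
  The power \<open>^\<close> on matrices is componentwise in the library, hence the iterated product.\<close>

definition reachable :: "real^'n^'n \<Rightarrow> real^'n \<Rightarrow> bool" where
  "reachable A B \<longleftrightarrow> span ((\<lambda>k. ((*v) A ^^ k) B) ` {..<CARD('n)}) = UNIV"

definition filter_bank :: "real^'n^'n \<Rightarrow> real^'n \<Rightarrow> complex \<Rightarrow> complex^'n" where
  "filter_bank A B z = matrix_inv (mat z - complex_matrix A) *v complex_vector B"

text \<open>The scalar \<open>G\<^sup>* \<Theta> G\<close> at \<open>z\<close>. The Hermitian form is real for symmetric \<open>\<Theta>\<close>, and
  \<^const>\<open>Re\<close> only changes its type.\<close>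

definition quad_form :: "real^'n^'n \<Rightarrow> real^'n \<Rightarrow> real^'n^'n \<Rightarrow> complex \<Rightarrow> real" where
  "quad_form A B \<Theta> z =
     (let g = filter_bank A B z in Re (\<Sum>i\<in>UNIV. cnj (g $ i) * (complex_matrix \<Theta> *v g) $ i))"

definition dual_domain :: "real^'n^'n \<Rightarrow> real^'n \<Rightarrow> (real^'n^'n) set" where
  "dual_domain A B =
     {\<Theta>. transpose \<Theta> = \<Theta> \<and> (\<forall>z\<in>unit_circle. 1 + quad_form A B \<Theta> z > 0)}"

definition model_density ::
    "real^'n^'n \<Rightarrow> real^'n \<Rightarrow> (complex \<Rightarrow> real) \<Rightarrow> real^'n^'n \<Rightarrow> complex \<Rightarrow> real" where
  "model_density A B \<Psi> \<Theta> z = \<Psi> z / (1 + quad_form A B \<Theta> z)"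

definition biased_covariance :: "nat \<Rightarrow> (nat \<Rightarrow> real) \<Rightarrow> nat \<Rightarrow> real" where
  "biased_covariance N y k = (\<Sum>t=1..N - k. y (t + k) * y t) / real N"

text \<open>Blackman-Tukey estimate with lag window \<open>w\<close> supported on lags smaller than \<open>M\<close>.
  A window that is constantly 1 gives the plain truncation, and, with \<open>M = N\<close>, the full biased
  correlogram. The sum is real because its coefficients are even in the lag.\<close>

definition correlogram ::
    "nat \<Rightarrow> (nat \<Rightarrow> real) \<Rightarrow> nat \<Rightarrow> (nat \<Rightarrow> real) \<Rightarrow> complex \<Rightarrow> real" where
  "correlogram N y M w z =
     Re (\<Sum>k\<in>{- int M<..<int M}.
           of_real (w (nat \<bar>k\<bar>) * biased_covariance N y (nat \<bar>k\<bar>)) * z powi (- k))"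

definition state_covariance ::
    "real^'n^'n \<Rightarrow> real^'n \<Rightarrow> (complex \<Rightarrow> real) \<Rightarrow> complex^'n^'n" where
  "state_covariance A B \<Omega> = (\<chi> i j. circle_integral
     (\<lambda>z. filter_bank A B z $ i * of_real (\<Omega> z) * cnj (filter_bank A B z $ j)))"

definition dual_cost :: "real^'n^'n \<Rightarrow> real^'n \<Rightarrow> (complex \<Rightarrow> real) \<Rightarrow> (complex \<Rightarrow> real) \<Rightarrow>
    real^'n^'n \<Rightarrow> real" where
  "dual_cost A B \<Psi> \<Omega> \<Theta> =
     circle_integral (\<lambda>z. \<Psi> z * ln (inverse (1 + quad_form A B \<Theta> z))) +
     Re (trace (state_covariance A B \<Omega> ** complex_matrix \<Theta>))"

definition causal_transform :: "(nat \<Rightarrow> real) \<Rightarrow> complex \<Rightarrow> complex" where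
  "causal_transform h z = (\<Sum>k. of_real (h k) * inverse z ^ k)"

text \<open>\<open>L\<close> is the transform of a causal stable impulse response that turns unit-variance white
  noise into a process with density \<open>\<Phi>\<close>. The noise is the normalized innovation of that process,
  i.e. it is in turn obtained from the present and past output: \<open>L\<close> has a causal stable inverse.
  This determines \<open>L\<close> on the circle up to sign.\<close>

definition shaping_filter :: "(complex \<Rightarrow> real) \<Rightarrow> (complex \<Rightarrow> complex) \<Rightarrow> bool" where
  "shaping_filter \<Phi> L \<longleftrightarrow>
     (\<exists>h. summable (\<lambda>k. \<bar>h k\<bar>) \<and> (\<forall>z\<in>unit_circle. L z = causal_transform h z)) \<and>
     (\<exists>h. summable (\<lambda>k. \<bar>h k\<bar>) \<and> (\<forall>z\<in>unit_circle. inverse (L z) = causal_transform h z)) \<and>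
     (\<forall>z\<in>unit_circle. of_real (\<Phi> z) = L z * cnj (L z))"

text \<open>Density \<open>L\<^sup>-\<^sup>1 \<Omega> L\<^sup>-\<^sup>*\<close> of the output of the whitening filter \<open>L\<^sup>-\<^sup>1\<close>: the
  one-step-ahead prediction error of a model with shaping filter \<open>L\<close> is the process filtered by
  \<open>h\<^sub>0 L\<^sup>-\<^sup>1\<close>, where \<open>h\<^sub>0\<close> is the leading impulse response coefficient of \<open>L\<close>, and
  normalization divides it by its model standard deviation.\<close>

definition prediction_error_density ::
    "(complex \<Rightarrow> complex) \<Rightarrow> (complex \<Rightarrow> real) \<Rightarrow> complex \<Rightarrow> real" where
  "prediction_error_density L \<Omega> z = Re (inverse (L z) * of_real (\<Omega> z) * cnj (inverse (L z)))"

definition weighted_IS ::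
    "(complex \<Rightarrow> real) \<Rightarrow> (complex \<Rightarrow> real) \<Rightarrow> (complex \<Rightarrow> real) \<Rightarrow> real" where
  "weighted_IS Q \<Phi>\<^sub>1 \<Phi>\<^sub>2 =
     circle_integral (\<lambda>z. Q z * (ln (\<Phi>\<^sub>2 z) - ln (\<Phi>\<^sub>1 z) + \<Phi>\<^sub>1 z * inverse (\<Phi>\<^sub>2 z) - 1))"

end

theory Submission
  imports Defs
begin

text \<open>
  Both costs are integrals over the circle, and on \<open>dual_domain A B\<close> they differ by a constant that
  does not depend on \<open>\<Theta>\<close>; hence they have the same minimizers. Write \<open>q\<close> for
  \<open>G\<^sup>* \<Theta> G\<close>. The phase of the shaping filter cancels in the prediction error density
  \<open>L\<^sup>-\<^sup>1 \<Omega> L\<^sup>-\<^sup>*\<close>, which is therefore the quotient \<open>\<Omega> (1 + q) / \<Psi>\<close> of the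
  actual density by the model density (\<open>prediction_error_density_eq\<close>). The integrand of the weighted
  Itakura-Saito distance from this density to 1 is then pointwise
    \<open>\<Psi> ln (1 + q)\<^sup>-\<^sup>1 + \<Omega> q + (\<Psi> (ln \<Psi> - ln \<Omega> - 1) + \<Omega>)\<close>,
  because the factor \<open>\<Psi>\<close> in the weight cancels the \<open>\<Psi>\<close> in the denominator of the linear term.
  The first summand is the logarithmic part of the dual cost; the second integrates to the trace of
  \<open>\<Sigma> \<Theta>\<close> (\<open>trace_state_covariance\<close>); the third is the constant
  (\<open>weighted_IS_eq_dual_cost\<close>).

  Splitting the integral is only legitimate if the three parts are integrable, as the integral of a
  nonintegrable function has the default value 0. All functions involved turn out to be continuous on
  the circle, the only substantial point being the filter bank \<open>(z I - A)\<^sup>-\<^sup>1 B\<close>, which has its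
  poles inside the disc (\<open>continuous_on_filter_bank\<close>).
\<close>

section \<open>Integration over the circle\<close>

lemma set_integrable_circle:
  fixes f :: "complex \<Rightarrow> 'a::{banach, second_countable_topology}"
  assumes "continuous_on unit_circle f"
  shows "set_integrable lborel {-pi..pi} (\<lambda>\<theta>. f (cis \<theta>))"
proof (rule borel_integrable_atLeastAtMost')
  have "continuous_on {-pi..pi} cis"
    by (intro continuous_intros)
  then show "continuous_on {-pi..pi} (\<lambda>\<theta>. f (cis \<theta>))"
    by (intro continuous_on_compose2[OF assms]) auto
qed

lemma circle_integral_cong:
  assumes "\<And>z. z \<in> unit_circle \<Longrightarrow> f z = g z"
  shows "circle_integral f = circle_integral g"
proof -
  have "f (cis \<theta>) = g (cis \<theta>)" for \<theta>
    by (rule assms) simp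
  then show ?thesis by (simp add: circle_integral_def)
qed

lemma circle_integral_bounded_linear:
  fixes f :: "complex \<Rightarrow> 'a::{banach, second_countable_topology}"
    and T :: "'a \<Rightarrow> 'b::{banach, second_countable_topology}"
  assumes "bounded_linear T" "continuous_on unit_circle f"
  shows "T (circle_integral f) = circle_integral (\<lambda>z. T (f z))"
proof -
  interpret T: bounded_linear T by fact
  show ?thesis
    using integral_bounded_linear[OF assms(1) set_integrable_circle[OF assms(2), unfolded set_integrable_def]]
    by (simp add: circle_integral_def set_lebesgue_integral_def T.scaleR)
qed

lemma circle_integral_add:
  fixes f g :: "complex \<Rightarrow> 'a::{banach, second_countable_topology}"
  assumes "continuous_on unit_circle f" "continuous_on unit_circle g"
  shows "circle_integral (\<lambda>z. f z + g z) = circle_integral f + circle_integral g"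
  by (simp add: circle_integral_def set_integral_add[OF assms[THEN set_integrable_circle]]
      scaleR_add_right)

lemma circle_integral_sum:
  fixes f :: "'i \<Rightarrow> complex \<Rightarrow> 'a::{banach, second_countable_topology}"
  assumes "finite I" "\<And>i. i \<in> I \<Longrightarrow> continuous_on unit_circle (f i)"
  shows "circle_integral (\<lambda>z. \<Sum>i\<in>I. f i z) = (\<Sum>i\<in>I. circle_integral (f i))"
  using assms
proof (induction I rule: finite_induct)
  case empty
  show ?case by (simp add: circle_integral_def set_lebesgue_integral_def)
next
  case (insert i I)
  then show ?case by (simp add: circle_integral_add continuous_on_sum)
qed

section \<open>Continuity of the functions on the circle\<close>

lemma continuous_on_det [continuous_intros]:
  fixes M :: "'a::topological_space \<Rightarrow> 'b::real_normed_field^'n^'n"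
  assumes "\<And>i j. continuous_on S (\<lambda>x. M x $ i $ j)"
  shows "continuous_on S (\<lambda>x. det (M x))"
  unfolding det_def by (intro continuous_intros assms)

lemma matrix_inv_right:
  assumes "invertible M"
  shows "M ** matrix_inv M = mat 1"
  using assms someI_ex[of "\<lambda>M'. M ** M' = mat 1 \<and> M' ** M = mat 1"]
  by (auto simp: invertible_def matrix_inv_def)

lemma mat_mult_vector: "mat z *v v = z *s v"
  by (simp add: vec_eq_iff matrix_vector_mult_def mat_def if_distrib[where f = "\<lambda>c. c * _"]
      cong: if_cong)

lemma det_resolvent_nonzero:
  assumes "eigenvalues_in_open_disc A" "1 \<le> cmod z"
  shows "det (mat z - complex_matrix A) \<noteq> 0"
proof -
  have "v = 0" if "(mat z - complex_matrix A) *v v = 0" for v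
  proof (rule ccontr)
    assume "v \<noteq> 0"
    moreover have "complex_matrix A *v v = z *s v"
      using that by (simp add: matrix_vector_mult_diff_rdistrib mat_mult_vector)
    ultimately show False
      using assms unfolding eigenvalues_in_open_disc_def by (metis not_less)
  qed
  then show ?thesis
    by (simp flip: invertible_det_nz add: invertible_left_inverse matrix_left_invertible_ker)
qed

text \<open>By Cramer's rule each component is a quotient of determinants whose entries are affine in
  \<open>z\<close>. This avoids having to treat matrix inversion itself as a continuous map.\<close>

lemma continuous_on_filter_bank:
  assumes "eigenvalues_in_open_disc A"
  shows "continuous_on unit_circle (\<lambda>z. filter_bank A B z $ k)"
proof -
  define R where "R = (\<lambda>z. mat z - complex_matrix A)"
  define C where "C = (\<lambda>z. \<chi> i j. if j = k then complex_vector B $ i else R z $ i $ j)"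
  have nz: "det (R z) \<noteq> 0" if "z \<in> unit_circle" for z
    using det_resolvent_nonzero[OF assms, of z] that by (simp add: R_def)
  have cramer_k: "filter_bank A B z $ k = det (C z) / det (R z)" if "z \<in> unit_circle" for z
  proof -
    have "R z ** matrix_inv (R z) = mat 1"
      using nz[OF that] by (intro matrix_inv_right) (simp add: invertible_det_nz)
    then have "R z *v filter_bank A B z = complex_vector B"
      by (simp add: filter_bank_def R_def matrix_vector_mul_assoc)
    then show ?thesis
      using cramer[OF nz[OF that]] by (simp add: C_def)
  qed
  have entry: "continuous_on unit_circle (\<lambda>z. R z $ i $ j)" for i j
    by (cases "i = j") (auto simp: R_def mat_def intro!: continuous_intros)
  have "continuous_on unit_circle (\<lambda>z. C z $ i $ j)" for i j
    by (cases "j = k") (simp_all add: C_def entry)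
  then have "continuous_on unit_circle (\<lambda>z. det (C z) / det (R z))"
    using nz by (intro continuous_on_divide continuous_on_det entry) auto
  then show ?thesis
    by (rule continuous_on_eq) (simp add: cramer_k)
qed

lemma continuous_on_quad_form:
  assumes "eigenvalues_in_open_disc A"
  shows "continuous_on unit_circle (quad_form A B \<Theta>)"
proof -
  have "quad_form A B \<Theta> = (\<lambda>z. Re (\<Sum>i\<in>UNIV. cnj (filter_bank A B z $ i) *
      (\<Sum>j\<in>UNIV. complex_matrix \<Theta> $ i $ j * filter_bank A B z $ j)))"
    by (simp add: fun_eq_iff quad_form_def Let_def matrix_vector_mult_def)
  moreover have "continuous_on unit_circle (\<lambda>z. Re (\<Sum>i\<in>UNIV. cnj (filter_bank A B z $ i) *
      (\<Sum>j\<in>UNIV. complex_matrix \<Theta> $ i $ j * filter_bank A B z $ j)))"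
    by (intro continuous_on_Re continuous_on_sum continuous_on_mult continuous_on_cnj
        continuous_on_const continuous_on_filter_bank assms)
  ultimately show ?thesis by (simp only:)
qed

lemma continuous_on_rational:
  assumes "rational_on_circle \<Phi>"
  shows "continuous_on unit_circle \<Phi>"
proof -
  from assms obtain p q :: "real poly" where
    q: "\<And>z. z \<in> unit_circle \<Longrightarrow> poly (map_poly of_real q) z \<noteq> 0" and
    eq: "\<And>z. z \<in> unit_circle \<Longrightarrow>
      complex_of_real (\<Phi> z) = poly (map_poly of_real p) z / poly (map_poly of_real q) z"
    unfolding rational_on_circle_def by blast
  have "continuous_on unit_circle
    (\<lambda>z. Re (poly (map_poly of_real p) z / poly (map_poly of_real q) z))"
    using q by (intro continuous_intros) auto
  then show ?thesis
    by (rule continuous_on_eq) (simp flip: eq)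
qed

lemma continuous_on_correlogram: "continuous_on unit_circle (correlogram N y M w)"
  unfolding correlogram_def [abs_def] by (intro continuous_intros) auto

section \<open>Equality of the two costs up to a constant\<close>

text \<open>The trace of the product is linear in the first factor, so it moves under the integral, where
  cyclicity turns the trace of \<open>G \<Omega> G\<^sup>* \<Theta>\<close> into the scalar \<open>\<Omega> G\<^sup>* \<Theta> G\<close>.\<close>

lemma trace_state_covariance:
  assumes "eigenvalues_in_open_disc A" "continuous_on unit_circle \<Omega>"
  shows "Re (trace (state_covariance A B \<Omega> ** complex_matrix \<Theta>)) =
    circle_integral (\<lambda>z. \<Omega> z * quad_form A B \<Theta> z)"
proof -
  let ?G = "\<lambda>z i. filter_bank A B z $ i"
  let ?t = "\<lambda>i j z. ?G z i * of_real (\<Omega> z) * cnj (?G z j) * of_real (\<Theta> $ j $ i)"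
  have S: "continuous_on unit_circle (\<lambda>z. ?G z i * of_real (\<Omega> z) * cnj (?G z j))" for i j
    by (intro continuous_intros continuous_on_filter_bank assms)
  have t: "continuous_on unit_circle (?t i j)" for i j
    by (intro continuous_intros S)
  have "trace (state_covariance A B \<Omega> ** complex_matrix \<Theta>) =
      (\<Sum>i\<in>UNIV. \<Sum>j\<in>UNIV. circle_integral (?t i j))"
    using circle_integral_bounded_linear[OF bounded_linear_mult_left S]
    by (simp add: trace_def matrix_matrix_mult_def state_covariance_def complex_matrix_def)
  also have "\<dots> = circle_integral (\<lambda>z. \<Sum>i\<in>UNIV. \<Sum>j\<in>UNIV. ?t i j z)"
    by (simp add: circle_integral_sum t continuous_on_sum)
  also have "Re \<dots> = circle_integral (\<lambda>z. Re (\<Sum>i\<in>UNIV. \<Sum>j\<in>UNIV. ?t i j z))"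
    by (intro circle_integral_bounded_linear bounded_linear_Re continuous_on_sum t)
  also have "\<dots> = circle_integral (\<lambda>z. \<Omega> z * quad_form A B \<Theta> z)"
  proof (rule circle_integral_cong)
    fix z
    have "(\<Sum>i\<in>UNIV. \<Sum>j\<in>UNIV. ?t i j z) = of_real (\<Omega> z) *
        (\<Sum>j\<in>UNIV. cnj (?G z j) * (complex_matrix \<Theta> *v filter_bank A B z) $ j)"
      by (subst sum.swap)
        (simp add: matrix_vector_mult_def complex_matrix_def sum_distrib_left mult_ac)
    then show "Re (\<Sum>i\<in>UNIV. \<Sum>j\<in>UNIV. ?t i j z) = \<Omega> z * quad_form A B \<Theta> z"
      by (simp only: quad_form_def Let_def times_complex.sel Re_complex_of_real Im_complex_of_real
          mult_zero_left diff_zero)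
  qed
  finally show ?thesis .
qed

text \<open>In the scalar case the phases of \<open>L\<^sup>-\<^sup>1\<close> and \<open>L\<^sup>-\<^sup>*\<close> cancel, so whitening by \<open>L\<close> amounts to
  dividing by the model density.\<close>

lemma prediction_error_density_eq:
  assumes "shaping_filter \<Phi> L" "z \<in> unit_circle"
  shows "prediction_error_density L \<Omega> z = \<Omega> z / \<Phi> z"
proof -
  have "complex_of_real (\<Phi> z) = L z * cnj (L z)"
    using assms unfolding shaping_filter_def by blast
  then have "inverse (L z) * of_real (\<Omega> z) * cnj (inverse (L z)) = of_real (\<Omega> z / \<Phi> z)"
    by (simp add: field_simps)
  then show ?thesis by (simp only: prediction_error_density_def Re_complex_of_real)
qed

text \<open>The last integrand is free of \<open>\<Theta>\<close>, and this is what makes the two minimization problems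
  equivalent. Positivity of all three of \<open>\<Psi>\<close>, \<open>\<Omega>\<close> and \<open>1 + q\<close> is needed to split the
  logarithm.\<close>

lemma weighted_IS_eq_dual_cost:
  assumes A: "eigenvalues_in_open_disc A"
    and \<Theta>: "\<Theta> \<in> dual_domain A B"
    and L: "shaping_filter (model_density A B \<Psi> \<Theta>) L"
    and \<Psi>: "continuous_on unit_circle \<Psi>" "\<And>z. z \<in> unit_circle \<Longrightarrow> \<Psi> z > 0"
    and \<Omega>: "continuous_on unit_circle \<Omega>" "\<And>z. z \<in> unit_circle \<Longrightarrow> \<Omega> z > 0"
  shows "weighted_IS \<Psi> (prediction_error_density L \<Omega>) (\<lambda>_. 1) = dual_cost A B \<Psi> \<Omega> \<Theta> +
    circle_integral (\<lambda>z. \<Psi> z * (ln (\<Psi> z) - ln (\<Omega> z) - 1) + \<Omega> z)"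
    (is "_ = _ + circle_integral ?c")
proof -
  define q where "q = quad_form A B \<Theta>"
  have q: "continuous_on unit_circle q" "\<And>z. z \<in> unit_circle \<Longrightarrow> 1 + q z > 0"
    using \<Theta> continuous_on_quad_form[OF A] by (auto simp: q_def dual_domain_def)
  let ?a = "\<lambda>z. \<Psi> z * ln (inverse (1 + q z))"
  let ?b = "\<lambda>z. \<Omega> z * q z"
  have pos: "\<Psi> z \<noteq> 0" "\<Omega> z \<noteq> 0" "1 + q z \<noteq> 0" if "z \<in> unit_circle" for z
    using \<Psi>(2) \<Omega>(2) q(2) that by (metis less_irrefl)+
  have a: "continuous_on unit_circle ?a"
    using pos by (intro continuous_intros \<Psi> q) auto
  have b: "continuous_on unit_circle ?b"
    by (intro continuous_intros \<Omega> q)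
  have c: "continuous_on unit_circle ?c"
    using pos by (intro continuous_intros \<Psi> \<Omega>) auto
  have "weighted_IS \<Psi> (prediction_error_density L \<Omega>) (\<lambda>_. 1) =
      circle_integral (\<lambda>z. ?a z + ?b z + ?c z)"
    unfolding weighted_IS_def
  proof (rule circle_integral_cong)
    fix z assume z: "z \<in> unit_circle"
    have \<Lambda>: "prediction_error_density L \<Omega> z = \<Omega> z * (1 + q z) / \<Psi> z"
      by (simp add: prediction_error_density_eq[OF L z] model_density_def q_def)
    have "ln (prediction_error_density L \<Omega> z) = ln (\<Omega> z) + ln (1 + q z) - ln (\<Psi> z)"
      using \<Psi>(2)[OF z] \<Omega>(2)[OF z] q(2)[OF z] by (simp add: \<Lambda> ln_mult ln_div)
    moreover have "\<Psi> z * prediction_error_density L \<Omega> z = \<Omega> z + \<Omega> z * q z"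
      using pos(1)[OF z] by (simp add: \<Lambda> field_simps)
    moreover have "ln (inverse (1 + q z)) = - ln (1 + q z)"
      by (rule ln_inverse)
    ultimately show "\<Psi> z * (ln 1 - ln (prediction_error_density L \<Omega> z) +
        prediction_error_density L \<Omega> z * inverse 1 - 1) = ?a z + ?b z + ?c z"
      by (simp only: ln_one inverse_1 mult_1_right) (simp add: algebra_simps)
  qed
  also have "\<dots> = circle_integral ?a + circle_integral ?b + circle_integral ?c"
    by (simp add: circle_integral_add a b c continuous_on_add)
  also have "circle_integral ?a + circle_integral ?b = dual_cost A B \<Psi> \<Omega> \<Theta>"
    by (simp add: dual_cost_def trace_state_covariance[OF A \<Omega>(1)] q_def)
  finally show ?thesis .
qed

theorem mainTheorem6:
  fixes A :: "real^'n^'n" and B :: "real^'n"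
    and \<Psi> \<Omega> :: "complex \<Rightarrow> real"
    and y w :: "nat \<Rightarrow> real" and N M :: nat
    and L :: "real^'n^'n \<Rightarrow> complex \<Rightarrow> complex"
    and \<Theta>hat :: "real^'n^'n"
  assumes "CARD('n) > 1"
    and "eigenvalues_in_open_disc A"
    and "reachable A B"
    and "\<Psi> \<in> spectral_densities" and "rational_on_circle \<Psi>"
    and "1 \<le> M" and "M \<le> N" and "w 0 = 1"
    and "\<Omega> = correlogram N y M w"
    and "\<forall>z\<in>unit_circle. \<Omega> z > 0"
    and "\<forall>\<Theta>\<in>dual_domain A B. shaping_filter (model_density A B \<Psi> \<Theta>) (L \<Theta>)"
    and "is_arg_min (dual_cost A B \<Psi> \<Omega>) (\<lambda>\<Theta>. \<Theta> \<in> dual_domain A B) \<Theta>hat"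
  shows "is_arg_min (\<lambda>\<Theta>. weighted_IS \<Psi> (prediction_error_density (L \<Theta>) \<Omega>) (\<lambda>_. 1))
           (\<lambda>\<Theta>. \<Theta> \<in> dual_domain A B) \<Theta>hat"
proof -
  define c where "c = circle_integral (\<lambda>z. \<Psi> z * (ln (\<Psi> z) - ln (\<Omega> z) - 1) + \<Omega> z)"
  have \<Psi>: "continuous_on unit_circle \<Psi>" "\<And>z. z \<in> unit_circle \<Longrightarrow> \<Psi> z > 0"
    using assms(4) by (auto simp: spectral_densities_def intro: less_le_trans
        intro!: continuous_on_rational[OF assms(5)])
  have \<Omega>: "continuous_on unit_circle \<Omega>" "\<And>z. z \<in> unit_circle \<Longrightarrow> \<Omega> z > 0"
    using assms(10) by (simp_all add: assms(9) continuous_on_correlogram)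
  have "weighted_IS \<Psi> (prediction_error_density (L \<Theta>) \<Omega>) (\<lambda>_. 1) = dual_cost A B \<Psi> \<Omega> \<Theta> + c"
    if "\<Theta> \<in> dual_domain A B" for \<Theta>
    unfolding c_def using assms(11) that
    by (intro weighted_IS_eq_dual_cost[OF assms(2) that _ \<Psi> \<Omega>]) blast+
  then show ?thesis
    using assms(12) by (simp add: is_arg_min_def)
qed

end
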